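(* For any $n\in\mathbb{N}$, there are bipointed maps $\phi_n:\Sigma\square^n\to\square^{n+1}$ and $\psi_n:\square^{n+1}\to\Sigma\square^n$ with $\psi_n\circ\phi_n=\mathrm{id}$. That is, they exhibit the suspension $\Sigma\square^n$ as a retract, in the category of bipointed strict $\omega$-categories, of the naturally bipointed cube $\square^{n+1}$.
   Context: $\mathsf{sCat}_\omega$ is the 1-category of strict $\omega$-categories and strict functors. $\otimes^{\mathrm{lax}}$ is the (lax) Gray tensor product, a biclosed monoidal structure on $\mathsf{sCat}_\omega$; it is the essentially unique such structure which, on $\omega$-categories $\nu(K),\nu(L)$ associated to augmented directed complexes $K,L$ with strongly loop-free unital bases (Steiner complexes), is given by $\nu(K\otimes L)$, with $K\otimes L$ the usual tensor product of chain complexes, $d(x\otimes y)=dx\otimes y+(-1)^{|x|}x\otimes dy$, with basis the products of basis elements. Its unit is the terminal $\omega$-category $\square^0$. $\square^1=\{0\to1\}$ is the arrow category, and $\square^n=(\square^1)^{\otimes^{\mathrm{lax}}n}$ is the $n$-cube. The objects of $\square^n$ are the elements of $\{0,1\}^n$; write $\vec0=(0,\dots,0)$, $\vec1=(1,\dots,1)$. A bipointed strict $\omega$-category is a strict $\omega$-category $C$ with an ordered pair of objects (first and second point); bipointed maps are functors preserving both points. The natural bipointing of $\square^n$ is $(\vec0,\vec1)$. For a strict $\omega$-category $C$, the suspension $\Sigma C$ is the strict $\omega$-category with two objects $0,1$ and $\mathrm{Hom}_{\Sigma C}(0,0)=\mathrm{Hom}_{\Sigma C}(1,1)=\square^0$,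 $\mathrm{Hom}_{\Sigma C}(1,0)=\emptyset$, $\mathrm{Hom}_{\Sigma C}(0,1)=C$; it is bipointed by $(0,1)$. *)

theory Defs
  imports "HOL-Library.Poly_Mapping"
begin

section \<open>Strict omega-categories\<close>

text \<open>
  A strict \<open>\<omega>\<close>-category is given in one-sorted form (Street, Steiner): every cell of every
  dimension is an element of one set, and a cell of dimension at most \<open>n\<close> is identified with its
  identities in dimensions above \<open>n\<close>.  Composition is written in diagrammatic order:
  \<open>seq C n x y\<close> composes \<open>x\<close> followed by \<open>y\<close> along the \<open>n\<close>-cell \<open>tgt C n x = src C n y\<close>;
  its value on other arguments carries no meaning.
\<close>

record 'a omega_cat =
  cells :: "'a set"
  src :: "nat \<Rightarrow> 'a \<Rightarrow> 'a"
  tgt :: "nat \<Rightarrow> 'a \<Rightarrow> 'a"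
  seq :: "nat \<Rightarrow> 'a \<Rightarrow> 'a \<Rightarrow> 'a"

definition composable :: "'a omega_cat \<Rightarrow> nat \<Rightarrow> 'a \<Rightarrow> 'a \<Rightarrow> bool" where
  "composable C n x y \<longleftrightarrow> x \<in> cells C \<and> y \<in> cells C \<and> tgt C n x = src C n y"

locale strict_omega_category =
  fixes C :: "'a omega_cat"
  assumes src_closed: "x \<in> cells C \<Longrightarrow> src C n x \<in> cells C"
    and tgt_closed: "x \<in> cells C \<Longrightarrow> tgt C n x \<in> cells C"
    and seq_closed: "composable C n x y \<Longrightarrow> seq C n x y \<in> cells C"
    and globular_low:
      "\<lbrakk>x \<in> cells C; m < n\<rbrakk> \<Longrightarrow> src C m (src C n x) = src C m x"
      "\<lbrakk>x \<in> cells C; m < n\<rbrakk> \<Longrightarrow> src C m (tgt C n x) = src C m x"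
      "\<lbrakk>x \<in> cells C; m < n\<rbrakk> \<Longrightarrow> tgt C m (src C n x) = tgt C m x"
      "\<lbrakk>x \<in> cells C; m < n\<rbrakk> \<Longrightarrow> tgt C m (tgt C n x) = tgt C m x"
    and globular_high:
      "\<lbrakk>x \<in> cells C; m \<le> n\<rbrakk> \<Longrightarrow> src C n (src C m x) = src C m x"
      "\<lbrakk>x \<in> cells C; m \<le> n\<rbrakk> \<Longrightarrow> src C n (tgt C m x) = tgt C m x"
      "\<lbrakk>x \<in> cells C; m \<le> n\<rbrakk> \<Longrightarrow> tgt C n (src C m x) = src C m x"
      "\<lbrakk>x \<in> cells C; m \<le> n\<rbrakk> \<Longrightarrow> tgt C n (tgt C m x) = tgt C m x"
    and finite_dimensional: "x \<in> cells C \<Longrightarrow> \<exists>n. src C n x = x"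
    and src_seq: "composable C n x y \<Longrightarrow> src C n (seq C n x y) = src C n x"
    and tgt_seq: "composable C n x y \<Longrightarrow> tgt C n (seq C n x y) = tgt C n y"
    and src_seq_low:
      "\<lbrakk>composable C m x y; m < n\<rbrakk> \<Longrightarrow> src C n (seq C m x y) = seq C m (src C n x) (src C n y)"
    and tgt_seq_low:
      "\<lbrakk>composable C m x y; m < n\<rbrakk> \<Longrightarrow> tgt C n (seq C m x y) = seq C m (tgt C n x) (tgt C n y)"
    and unit_left: "x \<in> cells C \<Longrightarrow> seq C n (src C n x) x = x"
    and unit_right: "x \<in> cells C \<Longrightarrow> seq C n x (tgt C n x) = x"
    and assoc: "\<lbrakk>composable C n x y; composable C n y z\<rbrakk>
      \<Longrightarrow> seq C n (seq C n x y) z = seq C n x (seq C n y z)"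
    and interchange:
      "\<lbrakk>m < n; composable C n x y; composable C n x' y'; composable C m x x'; composable C m y y'\<rbrakk>
      \<Longrightarrow> seq C m (seq C n x y) (seq C n x' y') = seq C n (seq C m x x') (seq C m y y')"

definition objects :: "'a omega_cat \<Rightarrow> 'a set" where
  "objects C = {x \<in> cells C. src C 0 x = x}"

locale strict_functor =
  source: strict_omega_category C + target: strict_omega_category D
  for C :: "'a omega_cat" and D :: "'b omega_cat" +
  fixes F :: "'a \<Rightarrow> 'b"
  assumes map_closed: "x \<in> cells C \<Longrightarrow> F x \<in> cells D"
    and map_src: "x \<in> cells C \<Longrightarrow> F (src C n x) = src D n (F x)"
    and map_tgt: "x \<in> cells C \<Longrightarrow> F (tgt C n x) = tgt D n (F x)"
    and map_seq: "composable C n x y \<Longrightarrow> F (seq C n x y) = seq D n (F x) (F y)"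

text \<open>A bipointed strict \<open>\<omega>\<close>-category is a triple of the category, its first and its second point.\<close>

type_synonym 'a bipointed = "'a omega_cat \<times> 'a \<times> 'a"

definition bipointed_category :: "'a bipointed \<Rightarrow> bool" where
  "bipointed_category = (\<lambda>(C, p, q). strict_omega_category C \<and> p \<in> objects C \<and> q \<in> objects C)"

definition bipointed_map :: "'a bipointed \<Rightarrow> 'b bipointed \<Rightarrow> ('a \<Rightarrow> 'b) \<Rightarrow> bool" where
  "bipointed_map X Y F \<longleftrightarrow> bipointed_category X \<and> bipointed_category Y \<and>
     (case (X, Y) of ((C, p, q), (D, p', q')) \<Rightarrow> strict_functor C D F \<and> F p = p' \<and> F q = q')"


section \<open>Suspension\<close>

text \<open>
  An \<open>n\<close>-cell of \<open>C\<close> becomes an \<open>(n+1)\<close>-cell from \<open>Pt0\<close> to \<open>Pt1\<close>, so composition along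
  \<open>n\<close>-cells in \<open>C\<close> becomes composition along \<open>(n+1)\<close>-cells.  Besides that, only composites
  with identities exist.
\<close>

datatype 'a susp = Pt0 | Pt1 | Hom01 'a

fun susp_bd :: "(nat \<Rightarrow> 'a \<Rightarrow> 'a) \<Rightarrow> 'a susp \<Rightarrow> nat \<Rightarrow> 'a susp \<Rightarrow> 'a susp" where
  "susp_bd f p n Pt0 = Pt0"
| "susp_bd f p n Pt1 = Pt1"
| "susp_bd f p 0 (Hom01 c) = p"
| "susp_bd f p (Suc n) (Hom01 c) = Hom01 (f n c)"

fun susp_seq :: "(nat \<Rightarrow> 'a \<Rightarrow> 'a \<Rightarrow> 'a) \<Rightarrow> nat \<Rightarrow> 'a susp \<Rightarrow> 'a susp \<Rightarrow> 'a susp" where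
  "susp_seq f n Pt0 y = y"
| "susp_seq f n x Pt1 = x"
| "susp_seq f (Suc n) (Hom01 c) (Hom01 d) = Hom01 (f n c d)"
| "susp_seq f n x y = undefined"

definition suspension :: "'a omega_cat \<Rightarrow> 'a susp omega_cat" where
  "suspension C = \<lparr>
     cells = {Pt0, Pt1} \<union> Hom01 ` cells C,
     src = susp_bd (src C) Pt0,
     tgt = susp_bd (tgt C) Pt1,
     seq = susp_seq (seq C)\<rparr>"

definition bipointed_suspension :: "'a omega_cat \<Rightarrow> 'a susp bipointed" where
  "bipointed_suspension C = (suspension C, Pt0, Pt1)"


section \<open>Augmented directed complexes with basis\<close>

text \<open>
  An augmented directed complex with basis is recorded by its graded basis \<open>B\<close>, the boundary and
  the augmentation of basis elements.  Its group of \<open>n\<close>-chains is the free abelian group on the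
  basis elements of degree \<open>n\<close>, a subgroup of \<open>'b \<Rightarrow>\<^sub>0 int\<close>; its distinguished submonoid consists of
  the chains with non-negative coefficients.
\<close>

record 'b based_adc =
  basis :: "'b set"
  grade :: "'b \<Rightarrow> nat"
  bdry :: "'b \<Rightarrow> ('b \<Rightarrow>\<^sub>0 int)"
  aug :: "'b \<Rightarrow> int"

definition positive_chains :: "'b based_adc \<Rightarrow> nat \<Rightarrow> ('b \<Rightarrow>\<^sub>0 int) set" where
  "positive_chains K n =
     {c. Poly_Mapping.keys c \<subseteq> {b \<in> basis K. grade K b = n} \<and> (\<forall>b. 0 \<le> Poly_Mapping.lookup c b)}"

definition boundary :: "'b based_adc \<Rightarrow> ('b \<Rightarrow>\<^sub>0 int) \<Rightarrow> ('b \<Rightarrow>\<^sub>0 int)" where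
  "boundary K = frag_extend (bdry K)"

definition augmentation :: "'b based_adc \<Rightarrow> ('b \<Rightarrow>\<^sub>0 int) \<Rightarrow> int" where
  "augmentation K c = (\<Sum>b\<in>Poly_Mapping.keys c. Poly_Mapping.lookup c b * aug K b)"


subsection \<open>Tensor products\<close>

definition tensor_chain :: "('a \<Rightarrow>\<^sub>0 int) \<Rightarrow> ('b \<Rightarrow>\<^sub>0 int) \<Rightarrow> ('a \<times> 'b \<Rightarrow>\<^sub>0 int)" where
  "tensor_chain x y = frag_extend (\<lambda>a. frag_extend (\<lambda>b. frag_of (a, b)) y) x"

definition tensor :: "'a based_adc \<Rightarrow> 'b based_adc \<Rightarrow> ('a \<times> 'b) based_adc" where
  "tensor K L = \<lparr>
     basis = basis K \<times> basis L,
     grade = (\<lambda>(a, b). grade K a + grade L b),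
     bdry = (\<lambda>(a, b). tensor_chain (bdry K a) (frag_of b)
              + frag_cmul ((- 1) ^ grade K a) (tensor_chain (frag_of a) (bdry L b))),
     aug = (\<lambda>(a, b). aug K a * aug L b)\<rparr>"

text \<open>
  Renaming of basis elements along \<open>f\<close>, with left inverse \<open>g\<close>.  It serves to put all tensor powers
  of a complex into one type, the elementary tensor of \<open>b\<^sub>1, \<dots>, b\<^sub>n\<close> being the list \<open>[b\<^sub>1, \<dots>, b\<^sub>n]\<close>.
\<close>

definition relabel :: "('a \<Rightarrow> 'b) \<Rightarrow> ('b \<Rightarrow> 'a) \<Rightarrow> 'a based_adc \<Rightarrow> 'b based_adc" where
  "relabel f g K = \<lparr>
     basis = f ` basis K,
     grade = grade K \<circ> g,
     bdry = (\<lambda>b. frag_extend (frag_of \<circ> f) (bdry K (g b))),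
     aug = aug K \<circ> g\<rparr>"

definition unit_adc :: "'b list based_adc" where
  "unit_adc = \<lparr>basis = {[]}, grade = (\<lambda>_. 0), bdry = (\<lambda>_. 0), aug = (\<lambda>_. 1)\<rparr>"

primrec tensor_power :: "'b based_adc \<Rightarrow> nat \<Rightarrow> 'b list based_adc" where
  "tensor_power K 0 = unit_adc"
| "tensor_power K (Suc n) =
     relabel (\<lambda>(b, bs). b # bs) (\<lambda>bs. (hd bs, tl bs)) (tensor K (tensor_power K n))"


subsection \<open>The associated omega-category\<close>

text \<open>
  A cell of \<open>\<nu>(K)\<close> is a Steiner table \<open>(x\<^sub>0\<^sup>-, x\<^sub>0\<^sup>+ | x\<^sub>1\<^sup>-, x\<^sub>1\<^sup>+ | \<dots>)\<close>, represented by the function \<open>x\<close> with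
  \<open>x i False = x\<^sub>i\<^sup>-\<close> and \<open>x i True = x\<^sub>i\<^sup>+\<close>.  A table whose only nonzero entries are
  \<open>x\<^sub>0\<^sup>- = x\<^sub>0\<^sup>+ = b\<close> is the object given by the degree \<open>0\<close> basis element \<open>b\<close>.
\<close>

type_synonym 'b table = "nat \<Rightarrow> bool \<Rightarrow> ('b \<Rightarrow>\<^sub>0 int)"

definition nu_cells :: "'b based_adc \<Rightarrow> 'b table set" where
  "nu_cells K = {x.
     (\<forall>i s. x i s \<in> positive_chains K i) \<and>
     (\<exists>N. \<forall>i>N. \<forall>s. x i s = 0) \<and>
     (\<forall>s. augmentation K (x 0 s) = 1) \<and>
     (\<forall>i s. boundary K (x (Suc i) s) = x i True - x i False)}"

definition nu_bd :: "bool \<Rightarrow> nat \<Rightarrow> 'b table \<Rightarrow> 'b table" where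
  "nu_bd t n x = (\<lambda>i s. if i < n then x i s else if i = n then x n t else 0)"

definition nu :: "'b based_adc \<Rightarrow> 'b table omega_cat" where
  "nu K = \<lparr>
     cells = nu_cells K,
     src = nu_bd False,
     tgt = nu_bd True,
     seq = (\<lambda>n x y. (\<lambda>i s. x i s - nu_bd True n x i s + y i s))\<rparr>"

definition point_table :: "'b \<Rightarrow> 'b table" where
  "point_table b = (\<lambda>i s. if i = 0 then frag_of b else 0)"


section \<open>Cubes\<close>

datatype interval = I0 | I1 | I01

definition interval_adc :: "interval based_adc" where
  "interval_adc = \<lparr>
     basis = UNIV,
     grade = (\<lambda>b. if b = I01 then 1 else 0),
     bdry = (\<lambda>b. if b = I01 then frag_of I1 - frag_of I0 else 0),
     aug = (\<lambda>b. if b = I01 then 0 else 1)\<rparr>"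

text \<open>
  \<open>\<nu>(interval_adc)\<close> is the arrow category \<open>0 \<rightarrow> 1\<close>.  The tensor powers of \<open>interval_adc\<close> have strongly
  loop-free unital bases, and on \<open>\<omega>\<close>-categories associated to such complexes the Gray tensor
  product is \<open>\<nu>(K) \<otimes> \<nu>(L) = \<nu>(K \<otimes> L)\<close>.  So the \<open>n\<close>-th Gray tensor power of the arrow category is
  \<open>\<nu>\<close> of the \<open>n\<close>-th tensor power of \<open>interval_adc\<close>.
\<close>

definition cube :: "nat \<Rightarrow> interval list table omega_cat" where
  "cube n = nu (tensor_power interval_adc n)"

definition bipointed_cube :: "nat \<Rightarrow> interval list table bipointed" where
  "bipointed_cube n = (cube n, point_table (replicate n I0), point_table (replicate n I1))"

end

theory Submission
  imports Defs
begin

text \<open>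
  Write \<open>C\<close> for the chains of \<open>\<box>\<^sup>n\<close> and \<open>C \<otimes> I\<close> for those of \<open>\<box>\<^sup>n\<^sup>+\<^sup>1\<close>, splitting off the last coordinate.
  Collapsing the two faces \<open>C \<otimes> 0\<close> and \<open>C \<otimes> 1\<close> to points and sending \<open>b \<otimes> 01\<close> to the suspension of
  \<open>b\<close> is a positive chain map, which gives \<open>\<psi>\<close>.  Conversely \<open>C\<close> has positive contractions \<open>L\<close> onto its
  first and \<open>R\<close> onto its last vertex (up to sign), and \<open>b \<mapsto> L b \<otimes> 0 + b \<otimes> 01 + R b \<otimes> 1\<close>
  is a positive chain map out of the suspension: for a vertex \<open>b\<close> it is an edge path from
  \<open>(0, \<dots>, 0)\<close> through \<open>b \<otimes> 01\<close> to \<open>(1, \<dots>, 1)\<close>.  It gives \<open>\<phi>\<close>, and collapsing the two faces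
  leaves only \<open>b\<close>.
\<close>

section \<open>Strict \<open>\<omega>\<close>-categories of tables and suspensions\<close>

text \<open>Composition in \<open>nu K\<close> is \<open>x\<close> minus its target plus
  \<open>y\<close>, and truncation is additive. With \<open>nu_bd_low\<close> and
  \<open>nu_bd_high\<close> this turns most category axioms into identities of abelian
  groups.\<close>

lemma nu_bd_linear:
  "nu_bd t n (\<lambda>i s. x i s - y i s + z i s) = (\<lambda>i s. nu_bd t n x i s - nu_bd t n y i s + nu_bd t n z i s)"
  by (auto simp: nu_bd_def fun_eq_iff)

lemma nu_bd_low: "m < n \<Longrightarrow> nu_bd t m (nu_bd u n x) = nu_bd t m x"
  by (auto simp: nu_bd_def fun_eq_iff)

lemma nu_bd_high: "m \<le> n \<Longrightarrow> nu_bd t n (nu_bd u m x) = nu_bd u m x"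
  by (auto simp: nu_bd_def fun_eq_iff)

lemma boundary_zero [simp]: "boundary K 0 = 0"
  by (simp add: boundary_def)

lemma boundary_add: "boundary K (a + b) = boundary K a + boundary K b"
  by (simp add: boundary_def frag_extend_add)

lemma positive_chains_zero [simp]: "0 \<in> positive_chains K n"
  by (simp add: positive_chains_def)

lemma positive_chains_add:
  "a \<in> positive_chains K n \<Longrightarrow> b \<in> positive_chains K n \<Longrightarrow> a + b \<in> positive_chains K n"
  using Poly_Mapping.keys_add[of a b] by (fastforce simp: positive_chains_def lookup_add)

lemma nu_bd_closed:
  assumes "x \<in> nu_cells K" shows "nu_bd t n x \<in> nu_cells K"
proof -
  have "\<exists>N. \<forall>i>N. \<forall>s. nu_bd t n x i s = 0"
    by (intro exI[of _ n]) (auto simp: nu_bd_def)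
  \<comment> \<open>Truncation matters in two places. At \<open>Suc i = n\<close> both entries of
    level \<open>n\<close> of \<open>x\<close> have the same boundary; at \<open>i = n\<close> both
    entries equal \<open>x n t\<close>, so the difference is 0.\<close>
  moreover have "boundary K (nu_bd t n x (Suc i) s) = nu_bd t n x i True - nu_bd t n x i False" for i s
    using assms by (cases "Suc i" n rule: linorder_cases) (auto simp: nu_cells_def nu_bd_def)
  ultimately show ?thesis
    using assms by (auto simp: nu_cells_def nu_bd_def)
qed

text \<open>This is why the subtraction in a composite never destroys positivity.\<close>

lemma nu_seq_level:
  assumes "nu_bd True n x = nu_bd False n y"
  shows "x i s - nu_bd True n x i s + y i s =
    (if i < n then y i s else if i = n then (if s then y i s else x i s) else x i s + y i s)"
proof -
  have "x n True = y n False"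
    using fun_cong[OF fun_cong[OF assms, of n], of True] by (simp add: nu_bd_def)
  moreover have "i < n \<Longrightarrow> x i s = y i s"
    using fun_cong[OF fun_cong[OF assms, of i], of s] by (simp add: nu_bd_def)
  ultimately show ?thesis
    by (cases s) (auto simp: nu_bd_def)
qed

lemma nu_seq_closed:
  assumes x: "x \<in> nu_cells K" and y: "y \<in> nu_cells K" and xy: "nu_bd True n x = nu_bd False n y"
  shows "(\<lambda>i s. x i s - nu_bd True n x i s + y i s) \<in> nu_cells K" (is "?z \<in> _")
proof -
  note z = nu_seq_level[OF xy]
  have mid: "x n True = y n False"
    using fun_cong[OF fun_cong[OF xy, of n], of True] by (simp add: nu_bd_def)
  have low: "i < n \<Longrightarrow> x i s = y i s" for i s
    using fun_cong[OF fun_cong[OF xy, of i], of s] by (simp add: nu_bd_def)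
  obtain N M where NM: "\<forall>i>N. \<forall>s. x i s = 0" "\<forall>i>M. \<forall>s. y i s = 0"
    using x y by (auto simp: nu_cells_def)
  have "?z i s \<in> positive_chains K i" for i s
    unfolding z using x y by (auto simp: nu_cells_def positive_chains_add)
  moreover have "\<exists>N. \<forall>i>N. \<forall>s. ?z i s = 0"
    using NM by (intro exI[of _ "N + M + n"]) (auto simp: nu_bd_def)
  moreover have "augmentation K (?z 0 s) = 1" for s
    unfolding z using x y by (auto simp: nu_cells_def)
  \<comment> \<open>Above level \<open>n\<close> the boundaries of \<open>x\<close> and
    \<open>y\<close> add up; at \<open>i = n\<close> the sum telescopes through the common entry
    \<open>mid\<close>.\<close>
  moreover have "boundary K (?z (Suc i) s) = ?z i True - ?z i False" for i s
    unfolding z using x y low mid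
    by (cases "Suc i" n rule: linorder_cases) (auto simp: nu_cells_def boundary_add)
  ultimately show ?thesis
    by (simp add: nu_cells_def)
qed

theorem strict_omega_category_nu: "strict_omega_category (nu K)"
proof
  show "src (nu K) n (seq (nu K) n x y) = src (nu K) n x"
    if "composable (nu K) n x y" for n x y
    using that by (simp add: composable_def nu_def nu_bd_linear nu_bd_high)
  show "\<exists>n. src (nu K) n x = x" if "x \<in> cells (nu K)" for x
  proof -
    obtain N where "\<forall>i>N. \<forall>s. x i s = 0"
      using \<open>x \<in> cells (nu K)\<close> by (auto simp: nu_def nu_cells_def)
    then have "nu_bd False (Suc N) x = x"
      by (auto simp: nu_bd_def fun_eq_iff)
    then show ?thesis by (auto simp: nu_def)
  qed
  show "seq (nu K) n x y \<in> cells (nu K)" if "composable (nu K) n x y" for n x y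
    using that nu_seq_closed[of x K y n] by (simp add: composable_def nu_def)
  show "seq (nu K) m (seq (nu K) n x y) (seq (nu K) n x' y') =
      seq (nu K) n (seq (nu K) m x x') (seq (nu K) m y y')"
    if "m < n" and xy: "composable (nu K) n x y" and "composable (nu K) n x' y'"
      and "composable (nu K) m x x'" "composable (nu K) m y y'" for m n x y x' y'
  proof -
    \<comment> \<open>Both sides expand to \<open>x + y + x' + y'\<close> minus the
      \<open>n\<close>-targets of \<open>x\<close> and \<open>x'\<close> and the common
      \<open>m\<close>-target of \<open>x\<close> and \<open>y\<close>.\<close>
    have "nu_bd True m x = nu_bd True m y"
      using xy \<open>m < n\<close> nu_bd_low[of m n True True x] nu_bd_low[of m n True False y]
      by (simp add: composable_def nu_def)
    then show ?thesis
      using \<open>m < n\<close> by (simp add: nu_def nu_bd_linear nu_bd_low nu_bd_high fun_eq_iff)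
  qed
qed (auto simp: composable_def nu_def nu_bd_linear nu_bd_low nu_bd_high nu_bd_closed fun_eq_iff)

section \<open>Suspensions\<close>

lemma suspension_sel [simp]:
  "cells (suspension C) = {Pt0, Pt1} \<union> Hom01 ` cells C"
  "src (suspension C) = susp_bd (src C) Pt0"
  "tgt (suspension C) = susp_bd (tgt C) Pt1"
  "seq (suspension C) = susp_seq (seq C)"
  by (simp_all add: suspension_def)

text \<open>There is no cell from \<open>Pt1\<close> to \<open>Pt0\<close>, so two
  \<open>Hom01\<close> cells never compose along dimension 0. In particular the
  \<open>undefined\<close> clause of \<open>susp_seq\<close> is never reached.\<close>

lemma composable_suspension_cases:
  assumes "composable (suspension C) n x y"
  obtains (pt0) "x = Pt0" "y = Pt0"
  | (pt1) "x = Pt1" "y = Pt1"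
  | (left) c where "n = 0" "x = Pt0" "y = Hom01 c" "c \<in> cells C"
  | (right) c where "n = 0" "x = Hom01 c" "y = Pt1" "c \<in> cells C"
  | (hom) m c d where "n = Suc m" "x = Hom01 c" "y = Hom01 d" "composable C m c d"
  using assms by (cases n) (auto simp: composable_def)

theorem strict_omega_category_suspension:
  assumes "strict_omega_category C"
  shows "strict_omega_category (suspension C)"
proof -
  interpret strict_omega_category C by fact
  show ?thesis
  proof
    fix x n assume x: "x \<in> cells (suspension C)"
    show "src (suspension C) n x \<in> cells (suspension C)"
      using x by (cases n) (auto simp: src_closed)
    show "tgt (suspension C) n x \<in> cells (suspension C)"
      using x by (cases n) (auto simp: tgt_closed)
    show "\<exists>n. src (suspension C) n x = x"
    proof (cases x)
      case (Hom01 c)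
      then obtain k where "src C k c = c" using x finite_dimensional by auto
      then show ?thesis using Hom01 by (intro exI[of _ "Suc k"]) simp
    qed auto
    show "seq (suspension C) n (src (suspension C) n x) x = x"
      using x by (cases n) (auto simp: unit_left)
    show "seq (suspension C) n x (tgt (suspension C) n x) = x"
      using x by (cases n) (auto simp: unit_right)
  next
    fix x m n assume x: "x \<in> cells (suspension C)" and mn: "m < (n::nat)"
    obtain k where n: "n = Suc k" using mn by (cases n) auto
    show "src (suspension C) m (src (suspension C) n x) = src (suspension C) m x"
      "src (suspension C) m (tgt (suspension C) n x) = src (suspension C) m x"
      "tgt (suspension C) m (src (suspension C) n x) = tgt (suspension C) m x"
      "tgt (suspension C) m (tgt (suspension C) n x) = tgt (suspension C) m x"
      using x mn n by (cases m; auto simp: globular_low)+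
  next
    fix x m n assume x: "x \<in> cells (suspension C)" and mn: "m \<le> (n::nat)"
    show "src (suspension C) n (src (suspension C) m x) = src (suspension C) m x"
      "src (suspension C) n (tgt (suspension C) m x) = tgt (suspension C) m x"
      "tgt (suspension C) n (src (suspension C) m x) = src (suspension C) m x"
      "tgt (suspension C) n (tgt (suspension C) m x) = tgt (suspension C) m x"
      using x mn by (cases m; cases n; auto simp: globular_high)+
  next
    fix n x y assume "composable (suspension C) n x y"
    then show "seq (suspension C) n x y \<in> cells (suspension C)"
      "src (suspension C) n (seq (suspension C) n x y) = src (suspension C) n x"
      "tgt (suspension C) n (seq (suspension C) n x y) = tgt (suspension C) n y"
      by (cases rule: composable_suspension_cases; auto simp: seq_closed src_seq tgt_seq)+
  next
    fix m n x y assume "composable (suspension C) m x y" and mn: "m < (n::nat)"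
    moreover obtain k where "n = Suc k" using mn by (cases n) auto
    ultimately show
      "src (suspension C) n (seq (suspension C) m x y) =
        seq (suspension C) m (src (suspension C) n x) (src (suspension C) n y)"
      "tgt (suspension C) n (seq (suspension C) m x y) =
        seq (suspension C) m (tgt (suspension C) n x) (tgt (suspension C) n y)"
      by (cases rule: composable_suspension_cases; auto simp: src_seq_low tgt_seq_low)+
  next
    fix n x y z assume xy: "composable (suspension C) n x y" and yz: "composable (suspension C) n y z"
    from xy yz show "seq (suspension C) n (seq (suspension C) n x y) z =
      seq (suspension C) n x (seq (suspension C) n y z)"
      by (cases rule: composable_suspension_cases;
          cases rule: composable_suspension_cases[OF yz]; auto simp: assoc)
  next
    fix m n x y x' y' assume "m < n"
      and xy: "composable (suspension C) n x y" and xy': "composable (suspension C) n x' y'"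
      and xx: "composable (suspension C) m x x'" and yy: "composable (suspension C) m y y'"
    obtain k where n: "n = Suc k" using \<open>m < n\<close> by (cases n) auto
    \<comment> \<open>As \<open>n > 0\<close>, an \<open>n\<close>-composable pair stays in one hom
      category. For \<open>m > 0\<close> interchange is inherited from \<open>C\<close>; for
      \<open>m = 0\<close> either \<open>x\<close>, \<open>y\<close> are both \<open>Pt0\<close> or
      \<open>x'\<close>, \<open>y'\<close> are both \<open>Pt1\<close>.\<close>
    have hom: "composable (suspension C) n u v \<Longrightarrow>
      u = Pt0 \<and> v = Pt0 \<or> u = Pt1 \<and> v = Pt1 \<or> (\<exists>c d. u = Hom01 c \<and> v = Hom01 d \<and> composable C k c d)"
      for u v by (erule composable_suspension_cases) (auto simp: n)
    show "seq (suspension C) m (seq (suspension C) n x y) (seq (suspension C) n x' y') =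
      seq (suspension C) n (seq (suspension C) m x x') (seq (suspension C) m y y')"
      using hom[OF xy] hom[OF xy'] xx yy \<open>m < n\<close> n
      by (cases m) (auto simp: composable_def intro!: interchange)
  qed
qed

section \<open>The chain complex of a cube\<close>

lemma frag_extend_extend:
  "frag_extend f (frag_extend g c) = frag_extend (\<lambda>b. frag_extend f (g b)) c"
  using subset_UNIV by (induction c rule: frag_induction) (auto simp: frag_extend_diff)

section \<open>Integer weights of chains\<close>

definition weight :: "('b \<Rightarrow> int) \<Rightarrow> ('b \<Rightarrow>\<^sub>0 int) \<Rightarrow> int" where
  "weight w c = (\<Sum>b\<in>Poly_Mapping.keys c. Poly_Mapping.lookup c b * w b)"

lemma augmentation_eq_weight: "augmentation K = weight (aug K)"
  by (simp add: fun_eq_iff augmentation_def weight_def)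

text \<open>Chains on a one-element basis are integers, so additivity is inherited from \<open>frag_extend\<close>.\<close>

lemma weight_eq_frag_extend:
  "weight w c = Poly_Mapping.lookup (frag_extend (\<lambda>b. frag_cmul (w b) (frag_of ())) c) ()"
  by (simp add: weight_def frag_extend_def lookup_sum)

lemma weight_zero [simp]: "weight w 0 = 0"
  by (simp add: weight_def)

lemma weight_frag_of [simp]: "weight w (frag_of b) = w b"
  by (simp add: weight_def)

lemma weight_add: "weight w (a + b) = weight w a + weight w b"
  by (simp add: weight_eq_frag_extend frag_extend_add lookup_add)

lemma weight_diff: "weight w (a - b) = weight w a - weight w b"
  by (simp add: weight_eq_frag_extend frag_extend_diff lookup_minus)

lemma weight_cmul: "weight w (frag_cmul k a) = k * weight w a"
  by (simp add: weight_eq_frag_extend frag_extend_cmul)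

lemma weight_cong: "(\<And>b. b \<in> Poly_Mapping.keys c \<Longrightarrow> v b = w b) \<Longrightarrow> weight v c = weight w c"
  by (simp add: weight_def)

lemma weight_frag_extend: "weight w (frag_extend f c) = weight (\<lambda>b. weight w (f b)) c"
  using subset_UNIV by (induction c rule: frag_induction) (auto simp: frag_extend_diff weight_diff)

lemma weight_zero_weight [simp]: "weight (\<lambda>_. 0) c = 0"
  by (simp add: weight_def)

lemma weight_nonneg:
  assumes "\<And>b. 0 \<le> Poly_Mapping.lookup c b" "\<And>b. b \<in> Poly_Mapping.keys c \<Longrightarrow> 0 \<le> w b"
  shows "0 \<le> weight w c"
  using assms by (simp add: weight_def sum_nonneg)

lemma weight_pos_eq_zero:
  assumes "weight w c = 0" "\<And>b. 0 \<le> Poly_Mapping.lookup c b"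
    "\<And>b. b \<in> Poly_Mapping.keys c \<Longrightarrow> 0 < w b"
  shows "c = 0"
proof -
  have "\<forall>b\<in>Poly_Mapping.keys c. Poly_Mapping.lookup c b * w b = 0"
    using assms by (subst sum_nonneg_eq_0_iff[symmetric]) (auto simp: weight_def less_imp_le)
  then have "Poly_Mapping.keys c = {}"
    using assms(3) by (fastforce simp: in_keys_iff)
  then show ?thesis by simp
qed

section \<open>Explicit boundary of the cube\<close>

definition prepend :: "'a \<Rightarrow> ('a list \<Rightarrow>\<^sub>0 int) \<Rightarrow> ('a list \<Rightarrow>\<^sub>0 int)" where
  "prepend a = frag_extend (\<lambda>bs. frag_of (a # bs))"

definition postpend :: "'a \<Rightarrow> ('a list \<Rightarrow>\<^sub>0 int) \<Rightarrow> ('a list \<Rightarrow>\<^sub>0 int)" where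
  "postpend a = frag_extend (\<lambda>bs. frag_of (bs @ [a]))"

abbreviation cell_dim :: "interval list \<Rightarrow> nat" where
  "cell_dim bs \<equiv> count_list bs I01"

definition cell_aug :: "interval list \<Rightarrow> int" where
  "cell_aug bs = (if I01 \<in> set bs then 0 else 1)"

text \<open>The Leibniz rule of the tensor product at the first factor; the minus sign before the
  last term is the Koszul sign of passing \<open>I01\<close>.\<close>

primrec cell_bd :: "interval list \<Rightarrow> (interval list \<Rightarrow>\<^sub>0 int)" where
  "cell_bd [] = 0"
| "cell_bd (a # bs) =
    (if a = I01 then frag_of (I1 # bs) - frag_of (I0 # bs) - prepend I01 (cell_bd bs)
     else prepend a (cell_bd bs))"

abbreviation cube_bd :: "(interval list \<Rightarrow>\<^sub>0 int) \<Rightarrow> (interval list \<Rightarrow>\<^sub>0 int)" where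
  "cube_bd \<equiv> frag_extend cell_bd"

lemma cell_aug_simps [simp]:
  "cell_aug [] = 1"
  "cell_aug (a # bs) = (if a = I01 then 0 else cell_aug bs)"
  "cell_aug (bs @ cs) = cell_aug bs * cell_aug cs"
  by (auto simp: cell_aug_def)

lemmas frag_linear = frag_extend_diff frag_extend_add frag_extend_minus frag_extend_cmul

lemma frag_cmul_uminus: "frag_cmul (- k) x = - frag_cmul k x"
  by simp

lemma frag_cmul_diff_distrib2: "frag_cmul k (x - y) = frag_cmul k x - frag_cmul k y"
  by (rule poly_mapping_eqI) (simp add: lookup_minus right_diff_distrib)

lemmas frag_cmul_linear = frag_cmul_distrib2 frag_cmul_diff_distrib2 frag_cmul_uminus

lemma prepend_simps [simp]: "prepend a 0 = 0" "prepend a (frag_of bs) = frag_of (a # bs)"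
  by (simp_all add: prepend_def)

lemma prepend_linear:
  "prepend a (x + y) = prepend a x + prepend a y"
  "prepend a (x - y) = prepend a x - prepend a y"
  "prepend a (- x) = - prepend a x"
  "prepend a (frag_cmul k x) = frag_cmul k (prepend a x)"
  by (simp_all add: prepend_def frag_linear)

lemma postpend_simps [simp]: "postpend a 0 = 0" "postpend a (frag_of bs) = frag_of (bs @ [a])"
  by (simp_all add: postpend_def)

lemma postpend_linear:
  "postpend a (x + y) = postpend a x + postpend a y"
  "postpend a (x - y) = postpend a x - postpend a y"
  "postpend a (- x) = - postpend a x"
  "postpend a (frag_cmul k x) = frag_cmul k (postpend a x)"
  by (simp_all add: postpend_def frag_linear)

lemma prepend_postpend: "prepend a (postpend b c) = postpend b (prepend a c)"
  by (simp add: prepend_def postpend_def frag_extend_extend)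

text \<open>Tensor powers grow at the front of a list, but the suspension coordinate is split off at
  the end. Differentiating it means passing all of \<open>bs\<close>, hence the sign.\<close>

lemma cell_bd_snoc:
  "cell_bd (bs @ [a]) = postpend a (cell_bd bs) + frag_cmul ((- 1) ^ cell_dim bs)
     (if a = I01 then frag_of (bs @ [I1]) - frag_of (bs @ [I0]) else 0)"
proof (induction bs)
  case Nil
  show ?case by simp
next
  case (Cons b bs)
  then show ?case
    by (simp add: postpend_linear prepend_linear prepend_postpend frag_cmul_linear algebra_simps
       del: minus_frag_cmul)
qed

lemma cube_bd_postpend_end:
  "a \<noteq> I01 \<Longrightarrow> cube_bd (postpend a c) = postpend a (cube_bd c)"
  by (simp add: postpend_def frag_extend_extend cell_bd_snoc)

lemma cube_bd_prepend:
  "cube_bd (prepend a c) =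
    (if a = I01 then prepend I1 c - prepend I0 c - prepend I01 (cube_bd c) else prepend a (cube_bd c))"
  using subset_UNIV by (induction c rule: frag_induction) (auto simp: frag_linear prepend_linear)

lemma cell_bd_vertex: "cell_dim bs = 0 \<Longrightarrow> cell_bd bs = 0"
  by (induction bs) (auto split: if_splits)

text \<open>The two faces in each direction have opposite signs. This removes the constant 1 of
  \<open>height (I1 # bs)\<close> in \<open>height_cell_bd\<close>.\<close>

lemma weight_one_cell_bd [simp]: "weight (\<lambda>_. 1) (cell_bd bs) = 0"
  by (induction bs) (auto simp: weight_diff prepend_def weight_frag_extend)

lemma cell_aug_cell_bd [simp]: "weight cell_aug (cell_bd bs) = 0"
  by (induction bs) (auto simp: weight_diff prepend_def weight_frag_extend)

text \<open>Each coordinate \<open>I1\<close> counts with the Koszul sign that its face would have in the boundary,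
  so every direction of a basis element contributes \<open>+1\<close> to the height of its boundary.  This
  makes the cube loop-free.\<close>

primrec height :: "interval list \<Rightarrow> int" where
  "height [] = 0"
| "height (a # bs) = (case a of I0 \<Rightarrow> height bs | I1 \<Rightarrow> 1 + height bs | I01 \<Rightarrow> - height bs)"

lemma weight_prepend: "weight w (prepend a c) = weight (\<lambda>bs. w (a # bs)) c"
  by (simp add: prepend_def weight_frag_extend)

lemma weight_weight_add: "weight (\<lambda>b. v b + w b) c = weight v c + weight w c"
  by (simp add: weight_def distrib_left sum.distrib)

lemma weight_weight_uminus: "weight (\<lambda>b. - w b) c = - weight w c"
  by (simp add: weight_def sum_negf)

text \<open>A leading \<open>I01\<close> contributes 1 through its two end faces; on the remaining
  faces the signs in \<open>cell_bd\<close> and in \<open>height\<close> cancel.\<close>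

lemma height_cell_bd: "weight height (cell_bd bs) = int (cell_dim bs)"
proof (induction bs)
  case (Cons a bs)
  then show ?case
    by (cases a) (simp_all add: weight_diff weight_prepend weight_weight_add weight_weight_uminus)
qed simp

text \<open>The height of the boundary of \<open>c\<close> is the sum of its coefficients times
  positive dimensions, so it vanishes only for \<open>c = 0\<close>.\<close>

lemma positive_cycle_zero:
  assumes "cube_bd c = 0" "\<And>b. 0 \<le> Poly_Mapping.lookup c b"
    "\<And>b. b \<in> Poly_Mapping.keys c \<Longrightarrow> cell_dim b > 0"
  shows "c = 0"
proof (rule weight_pos_eq_zero)
  have "weight height (cube_bd c) = 0" using assms by simp
  then show "weight (int \<circ> cell_dim) c = 0"
    by (simp add: weight_frag_extend height_cell_bd o_def)
qed (use assms in auto)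

text \<open>The chain map retracting the cube onto one vertex; the factor \<open>cell_aug bs\<close>
  kills positive dimensions.\<close>

definition const_vertex :: "interval \<Rightarrow> interval list \<Rightarrow> (interval list \<Rightarrow>\<^sub>0 int)" where
  "const_vertex e bs = frag_cmul (cell_aug bs) (frag_of (map (\<lambda>_. e) bs))"

text \<open>Positive contraction of the cube onto the vertex with all coordinates \<open>e\<close>, where \<open>e'\<close> is
  the other end.\<close>

primrec contraction :: "interval \<Rightarrow> interval \<Rightarrow> interval list \<Rightarrow> (interval list \<Rightarrow>\<^sub>0 int)" where
  "contraction e e' [] = 0"
| "contraction e e' (a # bs) =
    prepend a (contraction e e' bs) + (if a = e' then prepend I01 (const_vertex e bs) else 0)"

lemma const_vertex_Cons:
  "const_vertex e (a # bs) = (if a = I01 then 0 else prepend e (const_vertex e bs))"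
  by (simp add: const_vertex_def prepend_linear)

lemma const_vertex_prepend:
  "frag_extend (const_vertex e) (prepend a c) =
    (if a = I01 then 0 else prepend e (frag_extend (const_vertex e) c))"
  using subset_UNIV
  by (induction c rule: frag_induction)
    (auto simp: frag_linear prepend_linear const_vertex_Cons)

lemma const_vertex_cell_bd: "frag_extend (const_vertex e) (cell_bd bs) = 0"
  by (induction bs) (auto simp: frag_extend_diff const_vertex_prepend const_vertex_Cons)

lemma contraction_prepend:
  "frag_extend (contraction e e') (prepend a c) =
    prepend a (frag_extend (contraction e e') c) +
      (if a = e' then prepend I01 (frag_extend (const_vertex e) c) else 0)"
  using subset_UNIV
  by (induction c rule: frag_induction) (auto simp: frag_linear prepend_linear)

lemma cube_bd_const_vertex:
  assumes "e \<noteq> I01" shows "cube_bd (const_vertex e bs) = 0"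
proof -
  have "cell_bd (map (\<lambda>_. e) bs) = 0"
    using assms by (intro cell_bd_vertex) (induction bs, auto)
  then show ?thesis by (simp add: const_vertex_def frag_linear)
qed

text \<open>Up to the sign \<open>(- 1) ^ cell_dim bs\<close>, this is a chain homotopy between the
  identity and \<open>const_vertex e\<close>. Leaving that sign out of \<open>contraction\<close>
  keeps it positive. The recursion is the tensor formula: keep the first coordinate and contract the
  rest, or contract the first and retract the rest.\<close>

lemma contraction_cell_bd:
  assumes "(e, e', k) \<in> {(I0, I1, 1), (I1, I0, - 1)}"
  shows "cube_bd (contraction e e' bs) = frag_extend (contraction e e') (cell_bd bs)
    + frag_cmul k (frag_cmul ((- 1) ^ cell_dim bs) (frag_of bs) - const_vertex e bs)"
proof (induction bs)
  case Nil
  show ?case by (simp add: const_vertex_def)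
next
  case (Cons a bs)
  have e: "e \<noteq> I01" using assms by auto
  show ?case
    using assms
    by (cases a) (auto simp: frag_linear cube_bd_prepend Cons.IH prepend_linear const_vertex_Cons cube_bd_const_vertex[OF e]
       contraction_prepend const_vertex_cell_bd algebra_simps frag_cmul_linear simp del: minus_frag_cmul)
qed

section \<open>Positive chain maps between the cube and the suspension\<close>

lemma interval_adc_sel [simp]:
  "basis interval_adc = UNIV"
  "grade interval_adc b = (if b = I01 then 1 else 0)"
  "bdry interval_adc b = (if b = I01 then frag_of I1 - frag_of I0 else 0)"
  "aug interval_adc b = (if b = I01 then 0 else 1)"
  by (simp_all add: interval_adc_def)

text \<open>Transfers the abstract tensor power to the recursive formulas. The length hypothesis
  keeps \<open>hd\<close> and \<open>tl\<close> in \<open>relabel\<close> meaningful.\<close>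

lemma tensor_power_interval:
  assumes "length bs = n"
  shows "grade (tensor_power interval_adc n) bs = cell_dim bs"
    and "bdry (tensor_power interval_adc n) bs = cell_bd bs"
    and "aug (tensor_power interval_adc n) bs = cell_aug bs"
  using assms
proof (induction n arbitrary: bs)
  case 0
  { case 1 then show ?case by (simp add: unit_adc_def) }
  { case 2 then show ?case by (simp add: unit_adc_def) }
  { case 3 then show ?case by (simp add: unit_adc_def) }
next
  case (Suc n)
  { case 1 with Suc.IH(1) show ?case
      by (cases bs) (auto simp: relabel_def tensor_def) }
  { case 2
    then obtain a cs where bs: "bs = a # cs" "length cs = n" by (cases bs) auto
    show ?case
      by (cases a) (simp_all add: bs Suc.IH(2) relabel_def tensor_def tensor_chain_def
        frag_linear frag_extend_extend prepend_def) }
  { case 3 with Suc.IH(3) show ?case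
      by (cases bs) (auto simp: relabel_def tensor_def) }
qed

lemma basis_tensor_power_interval: "basis (tensor_power interval_adc n) = {bs. length bs = n}"
proof (induction n)
  case (Suc n)
  have "(\<lambda>(b, bs). b # bs) ` (UNIV \<times> {bs. length bs = n}) = {bs :: interval list. length bs = Suc n}"
    by (force simp: length_Suc_conv image_iff)
  with Suc show ?case by (simp add: relabel_def tensor_def)
qed (auto simp: unit_adc_def)

section \<open>Positive chains and cells of the cube\<close>

definition cube_chains :: "nat \<Rightarrow> nat \<Rightarrow> (interval list \<Rightarrow>\<^sub>0 int) set" where
  "cube_chains n i = {c. (\<forall>b. 0 \<le> Poly_Mapping.lookup c b) \<and>
     (\<forall>b\<in>Poly_Mapping.keys c. length b = n \<and> cell_dim b = i)}"

lemma positive_chains_cube: "positive_chains (tensor_power interval_adc n) i = cube_chains n i"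
  by (auto simp: positive_chains_def cube_chains_def basis_tensor_power_interval tensor_power_interval)

lemma cells_cube:
  "x \<in> cells (cube n) \<longleftrightarrow> (\<forall>i s. x i s \<in> cube_chains n i) \<and> (\<exists>N. \<forall>i>N. \<forall>s. x i s = 0) \<and>
     (\<forall>s. weight cell_aug (x 0 s) = 1) \<and> (\<forall>i s. cube_bd (x (Suc i) s) = x i True - x i False)"
proof -
  have "augmentation (tensor_power interval_adc n) c = weight cell_aug c"
    "boundary (tensor_power interval_adc n) c = cube_bd c" if "c \<in> cube_chains n i" for c i
    using that unfolding augmentation_eq_weight boundary_def cube_chains_def
    by (auto intro!: weight_cong frag_extend_eq simp: tensor_power_interval)
  note eqs = this
  have nu: "x \<in> cells (cube n) \<longleftrightarrow> (\<forall>i s. x i s \<in> cube_chains n i) \<and> (\<exists>N. \<forall>i>N. \<forall>s. x i s = 0) \<and>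
     (\<forall>s. augmentation (tensor_power interval_adc n) (x 0 s) = 1) \<and>
     (\<forall>i s. boundary (tensor_power interval_adc n) (x (Suc i) s) = x i True - x i False)"
    by (simp add: cube_def nu_def nu_cells_def positive_chains_cube)
  show ?thesis
  \<comment> \<open>The explicit formulas hold only on lists of length \<open>n\<close>, so
    membership of the entries has to be settled first.\<close>
  proof (cases "\<forall>i s. x i s \<in> cube_chains n i")
    case True
    then have "augmentation (tensor_power interval_adc n) (x 0 s) = weight cell_aug (x 0 s)"
      "boundary (tensor_power interval_adc n) (x (Suc i) s) = cube_bd (x (Suc i) s)" for i s
      using eqs by blast+
    then show ?thesis unfolding nu by simp
  next
    case False
    then show ?thesis unfolding nu by blast
  qed
qed

lemma cube_sel [simp]:
  "src (cube n) = nu_bd False"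
  "tgt (cube n) = nu_bd True"
  "seq (cube n) = (\<lambda>n x y i s. x i s - nu_bd True n x i s + y i s)"
  by (simp_all add: cube_def nu_def)

lemma strict_omega_category_cube: "strict_omega_category (cube n)"
  unfolding cube_def by (rule strict_omega_category_nu)

lemma cube_chains_zero [simp]: "0 \<in> cube_chains n i"
  by (simp add: cube_chains_def)

lemma cube_chains_frag_of [simp]: "frag_of b \<in> cube_chains n i \<longleftrightarrow> length b = n \<and> cell_dim b = i"
  by (auto simp: cube_chains_def)

lemma cube_chains_add: "a \<in> cube_chains n i \<Longrightarrow> b \<in> cube_chains n i \<Longrightarrow> a + b \<in> cube_chains n i"
  using positive_chains_add unfolding positive_chains_cube[symmetric] .

lemma cube_chains_frag_extend:
  assumes "c \<in> cube_chains n i"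
    and "\<And>b. length b = n \<Longrightarrow> cell_dim b = i \<Longrightarrow> f b \<in> cube_chains m j"
  shows "frag_extend f c \<in> cube_chains m j"
proof -
  have f: "f b \<in> cube_chains m j" if "b \<in> Poly_Mapping.keys c" for b
    by (rule assms(2)) (use assms(1) that in \<open>auto simp: cube_chains_def\<close>)
  have "0 \<le> Poly_Mapping.lookup (frag_cmul (Poly_Mapping.lookup c b) (f b)) a"
    if "b \<in> Poly_Mapping.keys c" for a b
    using f[OF that] assms(1) by (simp add: cube_chains_def)
  then have "0 \<le> Poly_Mapping.lookup (frag_extend f c) a" for a
    unfolding frag_extend_def lookup_sum by (rule sum_nonneg)
  moreover have "length a = m \<and> cell_dim a = j" if a: "a \<in> Poly_Mapping.keys (frag_extend f c)" for a
  proof -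
    obtain b where "b \<in> Poly_Mapping.keys c" "a \<in> Poly_Mapping.keys (f b)"
      using a keys_frag_extend[of f c] by blast
    with f show ?thesis unfolding cube_chains_def by blast
  qed
  ultimately show ?thesis by (simp add: cube_chains_def)
qed

lemma prepend_in_cube_chains:
  "c \<in> cube_chains n i \<Longrightarrow> prepend a c \<in> cube_chains (Suc n) (if a = I01 then Suc i else i)"
  unfolding prepend_def by (erule cube_chains_frag_extend) auto

lemma postpend_in_cube_chains:
  "c \<in> cube_chains n i \<Longrightarrow> a \<noteq> I01 \<Longrightarrow> postpend a c \<in> cube_chains (Suc n) i"
  unfolding postpend_def by (erule cube_chains_frag_extend) auto

lemma const_vertex_in_cube_chains:
  "e \<noteq> I01 \<Longrightarrow> const_vertex e bs \<in> cube_chains (length bs) (cell_dim bs)"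
proof (induction bs)
  case (Cons a bs)
  then show ?case
    using prepend_in_cube_chains[of "const_vertex e bs" _ _ e] by (auto simp: const_vertex_Cons)
qed (simp add: const_vertex_def)

lemma contraction_in_cube_chains:
  assumes "e \<noteq> I01" "e' \<noteq> I01"
  shows "contraction e e' bs \<in> cube_chains (length bs) (Suc (cell_dim bs))"
proof (induction bs)
  case (Cons a bs)
  show ?case
    using prepend_in_cube_chains[OF Cons, of a] assms
      prepend_in_cube_chains[OF const_vertex_in_cube_chains, of e I01 bs]
    by (auto intro: cube_chains_add split: if_splits)
qed simp

section \<open>Chain maps shifting the degree\<close>

definition sweep :: "interval list \<Rightarrow> (interval list \<Rightarrow>\<^sub>0 int)" where
  "sweep bs = postpend I0 (contraction I0 I1 bs) + frag_of (bs @ [I01])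
    + postpend I1 (contraction I1 I0 bs)"

definition collapse :: "interval list \<Rightarrow> (interval list \<Rightarrow>\<^sub>0 int)" where
  "collapse bs = (if last bs = I01 then frag_of (butlast bs) else 0)"

text \<open>On 0-chains this counts the vertices in the last face. It decides between
  \<open>Pt0\<close> and \<open>Pt1\<close>.\<close>

definition end_aug :: "interval list \<Rightarrow> int" where
  "end_aug bs = (if last bs = I1 then cell_aug (butlast bs) else 0)"

lemma collapse_snoc [simp]: "collapse (bs @ [a]) = (if a = I01 then frag_of bs else 0)"
  by (simp add: collapse_def)

lemma end_aug_snoc [simp]: "end_aug (bs @ [a]) = (if a = I1 then cell_aug bs else 0)"
  by (simp add: end_aug_def)

lemma collapse_postpend: "frag_extend collapse (postpend a c) = (if a = I01 then c else 0)"
  using subset_UNIV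
  by (induction c rule: frag_induction) (auto simp: frag_linear postpend_linear)

lemma end_aug_postpend: "weight end_aug (postpend a c) = (if a = I1 then weight cell_aug c else 0)"
  using subset_UNIV
  by (induction c rule: frag_induction) (auto simp: weight_diff postpend_linear)

lemma sweep_in_cube_chains: "sweep bs \<in> cube_chains (Suc (length bs)) (Suc (cell_dim bs))"
  unfolding sweep_def
  by (intro cube_chains_add postpend_in_cube_chains contraction_in_cube_chains) auto

lemma collapse_in_cube_chains:
  "c \<in> cube_chains (Suc n) (Suc i) \<Longrightarrow> frag_extend collapse c \<in> cube_chains n i"
proof (erule cube_chains_frag_extend)
  fix b :: "interval list" assume "length b = Suc n" "cell_dim b = Suc i"
  then show "collapse b \<in> cube_chains n i"
    by (cases b rule: rev_cases) auto
qed

lemma collapse_sweep: "frag_extend collapse (frag_extend sweep c) = c"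
  using subset_UNIV
  by (induction c rule: frag_induction)
    (auto simp: frag_linear sweep_def collapse_postpend)

lemma map_const_replicate: "map (\<lambda>_. e) bs @ [e] = replicate (Suc (length bs)) e"
  by (simp add: map_replicate_const replicate_append_same)

text \<open>The two contractions produce \<open>bs @ [I0]\<close> and \<open>bs @ [I1]\<close> with
  signs that cancel the end faces of \<open>bs @ [I01]\<close>. What survives, for vertices only, is
  the difference of the two extreme vertices: the boundary of a suspended vertex.\<close>

lemma cube_bd_sweep_basis:
  "cube_bd (sweep bs) = frag_extend sweep (cell_bd bs) + frag_cmul (cell_aug bs)
     (frag_of (replicate (Suc (length bs)) I1) - frag_of (replicate (Suc (length bs)) I0))"
proof -
  have sweep: "frag_extend sweep c = postpend I0 (frag_extend (contraction I0 I1) c) + postpend I01 c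
      + postpend I1 (frag_extend (contraction I1 I0) c)" for c
    using subset_UNIV
    by (induction c rule: frag_induction) (simp_all add: frag_linear postpend_linear sweep_def)
  have const: "postpend e (const_vertex e bs) =
      frag_cmul (cell_aug bs) (frag_of (replicate (Suc (length bs)) e))" for e
    unfolding map_const_replicate[symmetric] by (simp add: const_vertex_def postpend_linear)
  have "cube_bd (contraction I0 I1 bs) = frag_extend (contraction I0 I1) (cell_bd bs)
      + (frag_cmul ((- 1) ^ cell_dim bs) (frag_of bs) - const_vertex I0 bs)"
    "cube_bd (contraction I1 I0 bs) = frag_extend (contraction I1 I0) (cell_bd bs)
      - (frag_cmul ((- 1) ^ cell_dim bs) (frag_of bs) - const_vertex I1 bs)"
    using contraction_cell_bd[of I0 I1 1 bs] contraction_cell_bd[of I1 I0 "- 1" bs] by simp_all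
  then show ?thesis
    by (simp add: sweep sweep_def frag_linear cube_bd_postpend_end cell_bd_snoc postpend_linear const
        frag_cmul_linear del: replicate.simps minus_frag_cmul)
qed

lemma cube_bd_sweep:
  assumes "c \<in> cube_chains n i"
  shows "cube_bd (frag_extend sweep c) = frag_extend sweep (cube_bd c) +
    frag_cmul (weight cell_aug c) (frag_of (replicate (Suc n) I1) - frag_of (replicate (Suc n) I0))"
proof -
  have "Poly_Mapping.keys c \<subseteq> {b. length b = n}"
    using assms by (auto simp: cube_chains_def)
  then show ?thesis
  proof (induction c rule: frag_induction)
    case (diff a b)
    then show ?case
      by (simp add: frag_extend_diff weight_diff frag_cmul_diff_distrib del: replicate.simps)
  qed (auto simp: cube_bd_sweep_basis simp del: replicate.simps)
qed

text \<open>Both faces are killed, so only cells ending in \<open>I01\<close> matter. The second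
  identity replaces the first in the lowest degree: for a vertex \<open>b\<close>, the edge
  \<open>b @ [I01]\<close> has exactly one end, the positive one, in the last face.\<close>

lemma collapse_boundary:
  assumes "c \<in> cube_chains (Suc n) i"
  shows "cube_bd (frag_extend collapse c) = frag_extend collapse (cube_bd c)"
    and "weight cell_aug (frag_extend collapse c) = weight end_aug (cube_bd c)"
proof -
  have S: "Poly_Mapping.keys c \<subseteq> {b. b \<noteq> []}"
    using assms by (auto simp: cube_chains_def)
  have *: "b \<noteq> [] \<Longrightarrow> cube_bd (collapse b) = frag_extend collapse (cell_bd b)"
    "b \<noteq> [] \<Longrightarrow> weight cell_aug (collapse b) = weight end_aug (cell_bd b)" for b
    by (cases b rule: rev_cases;
        auto simp: cell_bd_snoc frag_linear collapse_postpend weight_add weight_diff weight_cmul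
          end_aug_postpend cell_aug_def count_list_0_iff)+
  show "cube_bd (frag_extend collapse c) = frag_extend collapse (cube_bd c)"
    using S by (induction c rule: frag_induction) (auto simp: frag_linear *)
  show "weight cell_aug (frag_extend collapse c) = weight end_aug (cube_bd c)"
    using S by (induction c rule: frag_induction) (auto simp: frag_linear weight_diff *)
qed

lemma cell_aug_cube_chains: "c \<in> cube_chains n (Suc i) \<Longrightarrow> weight cell_aug c = 0"
  by (subst weight_cong[of c cell_aug "\<lambda>_. 0"])
    (auto simp: cube_chains_def cell_aug_def count_list_0_iff[symmetric] simp del: count_list_0_iff)

lemma cube_bd_cube_chains: "c \<in> cube_chains n 0 \<Longrightarrow> cube_bd c = 0"
  by (rule frag_extend_eq_0) (auto simp: cube_chains_def cell_bd_vertex)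

lemma positive_cycle_zero_cube_chains: "c \<in> cube_chains n (Suc i) \<Longrightarrow> cube_bd c = 0 \<Longrightarrow> c = 0"
  by (erule positive_cycle_zero) (auto simp: cube_chains_def)

section \<open>The retraction\<close>

definition unsusp_table :: "interval list table \<Rightarrow> interval list table" where
  "unsusp_table x = (\<lambda>i s. frag_extend collapse (x (Suc i) s))"

definition susp_table :: "nat \<Rightarrow> interval list table \<Rightarrow> interval list table" where
  "susp_table n x = (\<lambda>i s. case i of
     0 \<Rightarrow> frag_of (replicate (Suc n) (if s then I1 else I0))
   | Suc j \<Rightarrow> frag_extend sweep (x j s))"

fun susp_to_cube :: "nat \<Rightarrow> interval list table susp \<Rightarrow> interval list table" where
  "susp_to_cube n Pt0 = point_table (replicate (Suc n) I0)"
| "susp_to_cube n Pt1 = point_table (replicate (Suc n) I1)"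
| "susp_to_cube n (Hom01 x) = susp_table n x"

text \<open>On a cell both weights are 0 or 1 and say in which face its source and target vertices
  lie. A cell with both in one face becomes a point, a cell crossing from \<open>I0\<close> to
  \<open>I1\<close> a hom cell.\<close>

definition cube_to_susp :: "interval list table \<Rightarrow> interval list table susp" where
  "cube_to_susp x =
     (if weight end_aug (x 0 True) = 0 then Pt0
      else if weight end_aug (x 0 False) = 0 then Hom01 (unsusp_table x) else Pt1)"

lemma point_in_cells_cube:
  assumes "a \<noteq> I01" shows "point_table (replicate n a) \<in> cells (cube n)"
proof -
  have 0: "cell_dim (replicate n a) = 0" using assms by (induction n) auto
  then have "cell_aug (replicate n a) = 1"
    by (simp add: cell_aug_def count_list_0_iff)
  then show ?thesis
    using 0 unfolding cells_cube point_table_def by (auto simp: cell_bd_vertex)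
qed

lemma nu_bd_point_table [simp]: "nu_bd t n (point_table b) = point_table b"
  by (auto simp: nu_bd_def point_table_def fun_eq_iff)

lemma nu_bd_susp_table:
  "nu_bd t 0 (susp_table n x) = point_table (replicate (Suc n) (if t then I1 else I0))"
  "nu_bd t (Suc m) (susp_table n x) = susp_table n (nu_bd t m x)"
  by (auto simp: nu_bd_def susp_table_def point_table_def fun_eq_iff split: nat.split)

lemma susp_table_in_cells_cube:
  assumes "x \<in> cells (cube n)" shows "susp_table n x \<in> cells (cube (Suc n))"
proof -
  have x: "x i s \<in> cube_chains n i" "weight cell_aug (x 0 s) = 1"
    "cube_bd (x (Suc i) s) = x i True - x i False" for i s
    using assms by (auto simp: cells_cube)
  obtain N where N: "\<forall>i>N. \<forall>s. x i s = 0"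
    using assms by (auto simp: cells_cube)
  have vertex: "cell_dim (replicate (Suc n) a) = 0" "cell_aug (replicate (Suc n) a) = 1" if "a \<noteq> I01" for a
    using that by (induction n) auto
  have "susp_table n x i s \<in> cube_chains (Suc n) i" for i s
    using x(1)[of "i - 1" s] vertex sweep_in_cube_chains
    by (cases i) (auto simp: susp_table_def simp del: replicate.simps intro!: cube_chains_frag_extend)
  moreover have "\<forall>i>Suc N. \<forall>s. susp_table n x i s = 0"
    using N by (auto simp: susp_table_def split: nat.split)
  \<comment> \<open>At \<open>i = 0\<close> the entry \<open>x 0 s\<close> has boundary 0 and
    augmentation 1, leaving the difference of the extreme vertices; at higher levels the
    augmentation vanishes.\<close>
  moreover have "cube_bd (susp_table n x (Suc i) s) = susp_table n x i True - susp_table n x i False" for i s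
    using x cell_aug_cube_chains[OF x(1)] cube_bd_cube_chains[OF x(1)]
    by (cases i) (simp_all add: susp_table_def cube_bd_sweep[OF x(1)] frag_linear del: replicate.simps)
  moreover have "weight cell_aug (susp_table n x 0 s) = 1" for s
    using vertex by (simp add: susp_table_def del: replicate.simps)
  ultimately show ?thesis
    unfolding cells_cube by blast
qed

lemma nu_bd_unsusp_table: "unsusp_table (nu_bd t (Suc m) x) = nu_bd t m (unsusp_table x)"
  by (auto simp: nu_bd_def unsusp_table_def fun_eq_iff)

context
  fixes n x
  assumes x: "x \<in> cells (cube (Suc n))"
begin

lemma cube_chain: "x i s \<in> cube_chains (Suc n) i"
  and cube_bd_level: "cube_bd (x (Suc i) s) = x i True - x i False"
  using x by (auto simp: cells_cube)

lemma unsusp_chain: "unsusp_table x i s \<in> cube_chains n i"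
  unfolding unsusp_table_def by (rule collapse_in_cube_chains) (rule cube_chain)

lemma unsusp_bd: "cube_bd (unsusp_table x (Suc i) s) = unsusp_table x i True - unsusp_table x i False"
  unfolding unsusp_table_def
  by (simp add: collapse_boundary(1)[OF cube_chain] cube_bd_level frag_linear)

lemma unsusp_aug:
  "weight cell_aug (unsusp_table x 0 s) = weight end_aug (x 0 True) - weight end_aug (x 0 False)"
  unfolding unsusp_table_def
  by (simp add: collapse_boundary(2)[OF cube_chain] cube_bd_level weight_diff)

text \<open>Each weight is between 0 and 1, since the vertices in the two faces together have
  augmentation 1. Their difference is the augmentation of a positive chain by
  \<open>unsusp_aug\<close>, which excludes a crossing from \<open>I1\<close> back to
  \<open>I0\<close>.\<close>

lemma end_aug_cases:
  obtains "weight end_aug (x 0 False) = 0" "weight end_aug (x 0 True) = 0"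
  | "weight end_aug (x 0 False) = 0" "weight end_aug (x 0 True) = 1"
  | "weight end_aug (x 0 False) = 1" "weight end_aug (x 0 True) = 1"
proof -
  have "0 \<le> weight end_aug (x 0 s)" for s
    using cube_chain[of 0 s] by (intro weight_nonneg) (auto simp: cube_chains_def end_aug_def cell_aug_def)
  moreover have "0 \<le> weight (\<lambda>b. cell_aug b + - end_aug b) (x 0 s)" for s
    using cube_chain[of 0 s]
    by (intro weight_nonneg) (auto simp: cube_chains_def end_aug_def cell_aug_def count_list_0_iff)
  then have "weight end_aug (x 0 s) \<le> 1" for s
    using x unfolding weight_weight_add weight_weight_uminus by (auto simp: cells_cube)
  moreover have "0 \<le> weight cell_aug (unsusp_table x 0 s)" for s
    using unsusp_chain[of 0 s] by (intro weight_nonneg) (auto simp: cube_chains_def cell_aug_def)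
  ultimately show ?thesis
    using that unfolding unsusp_aug by (smt (verit))
qed

text \<open>Level 0 is positive of augmentation 0, hence zero. Inductively every higher level is a
  positive cycle, and loop-freeness kills it.\<close>

lemma unsusp_table_degenerate:
  assumes "weight end_aug (x 0 False) = weight end_aug (x 0 True)"
  shows "unsusp_table x i s = 0"
proof (induction i arbitrary: s)
  case 0
  show ?case
    using unsusp_aug[of s] unsusp_chain[of 0 s] assms
    by (intro weight_pos_eq_zero[where w = cell_aug])
      (auto simp: cube_chains_def cell_aug_def count_list_0_iff)
next
  case (Suc i)
  then show ?case
    using unsusp_bd[of i s] by (intro positive_cycle_zero_cube_chains[OF unsusp_chain]) simp
qed

lemma unsusp_table_in_cells_cube:
  assumes "weight end_aug (x 0 False) = 0" "weight end_aug (x 0 True) = 1"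
  shows "unsusp_table x \<in> cells (cube n)"
proof -
  obtain N where "\<forall>i>N. \<forall>s. x i s = 0" using x by (auto simp: cells_cube)
  then have "\<forall>i>N. \<forall>s. unsusp_table x i s = 0" by (simp add: unsusp_table_def)
  then show ?thesis
    using assms by (auto simp: cells_cube unsusp_chain unsusp_bd unsusp_aug)
qed

end

theorem strict_functor_susp_to_cube:
  "strict_functor (suspension (cube n)) (cube (Suc n)) (susp_to_cube n)"
proof (intro strict_functor.intro strict_functor_axioms.intro strict_omega_category_suspension
    strict_omega_category_cube)
  fix x m assume x: "x \<in> cells (suspension (cube n))"
  show "susp_to_cube n x \<in> cells (cube (Suc n))"
    using x point_in_cells_cube[of _ "Suc n"] by (auto simp: susp_table_in_cells_cube simp del: replicate.simps)
  show "susp_to_cube n (src (suspension (cube n)) m x) = src (cube (Suc n)) m (susp_to_cube n x)"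
    "susp_to_cube n (tgt (suspension (cube n)) m x) = tgt (cube (Suc n)) m (susp_to_cube n x)"
    using x by (cases m; auto simp: nu_bd_susp_table)+
next
  fix m x y assume "composable (suspension (cube n)) m x y"
  then show "susp_to_cube n (seq (suspension (cube n)) m x y) =
      seq (cube (Suc n)) m (susp_to_cube n x) (susp_to_cube n y)"
  proof (cases rule: composable_suspension_cases)
    case (hom k c d)
    \<comment> \<open>\<open>sweep\<close> extends linearly; at level 0 all three terms are the same
      extreme vertex.\<close>
    have "susp_table n (\<lambda>i s. c i s - nu_bd True k c i s + d i s) =
      (\<lambda>i s. susp_table n c i s - susp_table n (nu_bd True k c) i s + susp_table n d i s)"
      by (auto simp: fun_eq_iff susp_table_def frag_linear split: nat.split)
    then show ?thesis using hom by (simp add: nu_bd_susp_table)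
  qed (auto simp: nu_bd_susp_table)
qed

lemma cube_to_susp_seq:
  assumes "composable (cube (Suc n)) m x y"
  shows "cube_to_susp (seq (cube (Suc n)) m x y) =
    susp_seq (seq (cube n)) m (cube_to_susp x) (cube_to_susp y)"
proof -
  have x: "x \<in> cells (cube (Suc n))" and y: "y \<in> cells (cube (Suc n))"
    and xy: "nu_bd True m x = nu_bd False m y"
    using assms by (auto simp: composable_def)
  let ?z = "\<lambda>i s. x i s - nu_bd True m x i s + y i s"
  note z = nu_seq_level[OF xy]
  show ?thesis
  proof (cases m)
    case 0
    have mid: "x 0 True = y 0 False"
      using fun_cong[OF fun_cong[OF xy, of 0], of True] 0 by (simp add: nu_bd_def)
    have "unsusp_table ?z = (\<lambda>i s. unsusp_table x i s + unsusp_table y i s)"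
      unfolding unsusp_table_def z using 0 by (simp add: frag_linear)
    moreover have "?z 0 False = x 0 False" "?z 0 True = y 0 True"
      unfolding z using 0 by auto
    \<comment> \<open>By \<open>mid\<close> the face can change only once along \<open>x\<close> and
      then \<open>y\<close>. So at most one factor is a hom cell, and the other contributes the zero
      table.\<close>
    ultimately show ?thesis
      using mid 0 unsusp_table_degenerate[OF x] unsusp_table_degenerate[OF y]
      by (cases rule: end_aug_cases[OF x]; cases rule: end_aug_cases[OF y])
        (simp_all add: cube_to_susp_def)
  next
    case (Suc k)
    \<comment> \<open>Equal vertices put both factors and the composite in the same branch of
      \<open>cube_to_susp\<close>.\<close>
    have low: "x 0 s = y 0 s" for s
      using fun_cong[OF fun_cong[OF xy, of 0], of s] Suc by (simp add: nu_bd_def)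
    have "?z 0 s = y 0 s" for s
      unfolding z using Suc by simp
    moreover have "unsusp_table ?z =
        (\<lambda>i s. unsusp_table x i s - nu_bd True k (unsusp_table x) i s + unsusp_table y i s)"
      unfolding nu_bd_unsusp_table[symmetric] Suc by (simp add: unsusp_table_def frag_linear)
    ultimately show ?thesis
      using low Suc by (simp add: cube_to_susp_def)
  qed
qed

theorem strict_functor_cube_to_susp:
  "strict_functor (cube (Suc n)) (suspension (cube n)) cube_to_susp"
proof (intro strict_functor.intro strict_functor_axioms.intro strict_omega_category_suspension
    strict_omega_category_cube)
  fix x m assume x: "x \<in> cells (cube (Suc n))"
  show "cube_to_susp x \<in> cells (suspension (cube n))"
    using unsusp_table_in_cells_cube[OF x]
    by (cases rule: end_aug_cases[OF x]) (auto simp: cube_to_susp_def)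
  \<comment> \<open>The branch depends on level 0 only: positive-dimensional boundaries preserve it,
    while a 0-boundary has equal entries there and goes to a point.\<close>
  have low: "nu_bd t 0 x 0 s = x 0 t" "nu_bd t (Suc k) x 0 s = x 0 s" for t s k
    by (simp_all add: nu_bd_def)
  show "cube_to_susp (src (cube (Suc n)) m x) = src (suspension (cube n)) m (cube_to_susp x)"
    "cube_to_susp (tgt (cube (Suc n)) m x) = tgt (suspension (cube n)) m (cube_to_susp x)"
    by (cases m; cases rule: end_aug_cases[OF x]; simp add: cube_to_susp_def low nu_bd_unsusp_table)+
qed (use cube_to_susp_seq in simp)

lemma end_aug_replicate: "a \<noteq> I01 \<Longrightarrow> end_aug (replicate (Suc n) a) = (if a = I1 then 1 else 0)"
  using end_aug_snoc[of "replicate n a" a]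
  by (simp add: replicate_append_same cell_aug_def split: if_splits)

lemma cube_to_susp_point:
  "cube_to_susp (point_table (replicate (Suc n) I0)) = Pt0"
  "cube_to_susp (point_table (replicate (Suc n) I1)) = Pt1"
  by (simp_all add: cube_to_susp_def point_table_def end_aug_replicate del: replicate.simps)

text \<open>\<open>susp_table\<close> starts in the first and ends in the last face, which forces
  the hom branch; \<open>collapse_sweep\<close> then applies level by level, for arbitrary
  tables.\<close>

lemma cube_to_susp_susp_to_cube: "cube_to_susp (susp_to_cube n x) = x"
proof (cases x)
  case (Hom01 c)
  then show ?thesis
    by (simp add: cube_to_susp_def susp_table_def end_aug_replicate unsusp_table_def collapse_sweep
        del: replicate.simps)
qed (simp_all add: cube_to_susp_point del: replicate.simps)

lemma bipointed_category_suspension: "bipointed_category (bipointed_suspension (cube n))"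
  by (simp add: bipointed_category_def bipointed_suspension_def objects_def
      strict_omega_category_suspension strict_omega_category_cube)

lemma bipointed_category_cube: "bipointed_category (bipointed_cube n)"
  by (simp add: bipointed_category_def bipointed_cube_def objects_def
      strict_omega_category_cube point_in_cells_cube)

theorem theorem3p2:
  fixes n :: nat
  shows "\<exists>\<phi> \<psi>. bipointed_map (bipointed_suspension (cube n)) (bipointed_cube (Suc n)) \<phi> \<and>
    bipointed_map (bipointed_cube (Suc n)) (bipointed_suspension (cube n)) \<psi> \<and>
    (\<forall>x \<in> cells (suspension (cube n)). (\<psi> \<circ> \<phi>) x = x)"
proof (intro exI conjI ballI)
  show "bipointed_map (bipointed_suspension (cube n)) (bipointed_cube (Suc n)) (susp_to_cube n)"
    using bipointed_category_suspension[of n] bipointed_category_cube[of "Suc n"]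
      strict_functor_susp_to_cube[of n]
    by (simp add: bipointed_map_def bipointed_suspension_def bipointed_cube_def)
  show "bipointed_map (bipointed_cube (Suc n)) (bipointed_suspension (cube n)) cube_to_susp"
    using bipointed_category_suspension[of n] bipointed_category_cube[of "Suc n"]
      strict_functor_cube_to_susp[of n]
    by (simp add: bipointed_map_def bipointed_suspension_def bipointed_cube_def cube_to_susp_point
        del: replicate.simps)
qed (simp add: cube_to_susp_susp_to_cube)

end
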